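(* Let $\mathbb{F}$ be a field, let $n$ be a positive integer, and let $S=(A_1,\dots,A_N)$ be an $N$-tuple of matrices $A_i\in M_n$. For any nonnegative integers $\tau$, $N$ with $N\ge\tau+1$, the following identity holds: $$S_\tau(A_1+A_2+\cdots+A_N)=\sum_{j=0}^{\tau-1}(-1)^{j}\binom{j+N-\tau-1}{N-\tau-1}\sum_{\substack{\Omega\in\Sigma(S)\\ |\Omega|=\tau-j}}S_\tau\left(\sum_{A_i\in\Omega}A_i\right).$$
   Context: $M_n$ denotes the set of $n\times n$ matrices over an arbitrary field $\mathbb{F}$. For $C\in M_n$, $S_\tau(C)$ is the $\tau$-th elementary symmetric function of $C$, defined by $\det(tI-C)=t^n-S_1(C)t^{n-1}+\cdots+(-1)^nS_n(C)$; equivalently $S_\tau(C)=\sum_{|\alpha|=\tau}\det(C(\alpha,\alpha))$, the sum over index sets $\alpha\subseteq\{1,\dots,n\}$ of size $\tau$, where $C(\alpha,\alpha)$ is the submatrix of $C$ in the rows and columns indexed by $\alpha$. By convention $S_0(C)=1$ (the coefficient of $t^n$) and $S_\tau(C)=0$ for $\tau>n$. For an $N$-tuple $S=(A_1,\dots,A_N)$ of matrices in $M_n$, $\Sigma(S)$ is the set of all formal sums of matrices of $S$ in which each $A_i$, $i=1,\dots,N$, appears at most once (equivalently, formal sums $\sum_{i\in I}A_i$ indexed by subsets $I\subseteq\{1,\dots,N\}$; the empty sum, i.e. the null matrix, may be included). $|\Omega|=k$ means that $\Omega$ is a formal sum with $k$ summands, and $A_i\in\Omega$ means that $A_i$ is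 a summand in $\Omega$.
   Formalization: For τ = 0 the printed sum from j = 0 to −1 is empty, so the identity would read S_0 = 1 = 0; here the sum for τ = 0 is taken to be the single term j = 0 (the empty formal sum), which gives 1 = 1. For τ ≥ 1 the formula is as printed. *)

theory Defs
  imports "HOL-Analysis.Determinants" "HOL-Computational_Algebra.Polynomial"
begin

definition charpoly :: "'a::comm_ring_1^'n^'n \<Rightarrow> 'a poly" where
  "charpoly C = det (mat (monom 1 1) - map_matrix (\<lambda>c. [:c:]) C)"

(* The sign comes from det(tI - C) = t^n - S_1(C) t^(n-1) + ... + (-1)^n S_n(C). The case
   distinction is needed because subtraction on nat truncates. *)
definition elem_sym :: "nat \<Rightarrow> 'a::field^'n^'n \<Rightarrow> 'a" where
  "elem_sym \<tau> C =
     (if \<tau> \<le> CARD('n) then (-1) ^ \<tau> * coeff (charpoly C) (CARD('n) - \<tau>) else 0)"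

(* A formal sum of matrices of the tuple (A_1, ..., A_N) is given by the set of indices of its
   summands, so equal matrices at different positions count as different summands. *)
definition formal_sums :: "nat \<Rightarrow> nat set set" where
  "formal_sums N = Pow {1..N}"

end

theory Submission
  imports Defs "HOL-Computational_Algebra.Formal_Power_Series"
begin

text \<open>
  Let \<open>f \<Omega> = S\<^sub>\<tau> (\<Sum>i\<in>\<Omega>. A i)\<close>. Since \<open>S\<^sub>\<tau>\<close> is a homogeneous polynomial of degree \<open>\<tau>\<close> in the
  entries of its argument, each of its terms involves at most \<open>\<tau>\<close> of the matrices, so that
  \<open>f \<Omega> = (\<Sum>T\<in>Pow \<Omega>. g T)\<close> with \<open>g T = 0\<close> as soon as \<open>card T > \<tau>\<close>. The identity holds for every
  set function of this kind (\<open>sum_over_layers\<close>). It is linear in \<open>g\<close>, so it suffices to count, for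
  each \<open>T\<close> of size \<open>t \<le> \<tau>\<close>, how often \<open>g T\<close> occurs on the right-hand side: the sets of size
  \<open>\<tau> - j\<close> that contain \<open>T\<close> number \<open>(N - t) choose (\<tau> - j - t)\<close>, and the sum of these numbers with the
  given alternating coefficients is \<open>1\<close> by the Vandermonde convolution for the upper arguments
  \<open>\<tau> - N\<close> and \<open>N - t\<close>. This count includes the layer \<open>j = \<tau>\<close>, which consists of the empty set
  alone; for \<open>\<tau> > 0\<close> it contributes \<open>S\<^sub>\<tau> 0 = 0\<close>.

  The expansion of \<open>f\<close> is obtained for all \<open>\<tau>\<close> at once. Say that a polynomial-valued set function
  \<open>p\<close> has weight \<open>m\<close> if \<open>p \<Omega> = (\<Sum>T\<in>Pow \<Omega>. g T)\<close> where every nonzero \<open>g T\<close> satisfies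
  \<open>degree (g T) + card T \<le> m\<close>. Weights add under multiplication (\<open>has_weight_mult\<close>), because a
  product of terms indexed by \<open>T1\<close> and \<open>T2\<close> may be indexed by \<open>T1 \<union> T2\<close>. The entries of
  \<open>t I - (\<Sum>i\<in>\<Omega>. A i)\<close> have weight \<open>1\<close>, so by the Leibniz formula the characteristic polynomial has
  weight \<open>n\<close>, and the bound \<open>card T \<le> \<tau>\<close> can be read off at the coefficient of \<open>t ^ (n - \<tau>)\<close>.
\<close>

section \<open>Set functions that are determined by their values on small sets\<close>

text \<open>
  By upper negation the coefficients are \<open>(- M) gchoose j\<close>, so the sum is the coefficient at \<open>d\<close> of
  \<open>(1 + X) powr (- M) * (1 + X) ^ (M + d) = (1 + X) ^ d\<close>.
\<close>

lemma alternating_Vandermonde: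
  assumes "M \<ge> 1"
  shows "(\<Sum>j\<le>d. (-1) ^ j * of_nat ((j + M - 1) choose (M - 1)) * of_nat ((M + d) choose (d - j)))
           = (1 :: 'a::comm_ring_1)"
proof -
  have upper_negation: "(-1) ^ j * of_nat ((j + M - 1) choose (M - 1)) = (- of_nat M :: rat) gchoose j" for j
  proof -
    have "((j + M - 1) choose (M - 1)) = ((j + M - 1) choose j)"
      using assms by (subst binomial_symmetric) auto
    moreover have "of_nat (j + M - 1) = (of_nat M + of_nat j - 1 :: rat)"
      using assms by (simp add: of_nat_diff)
    ultimately show ?thesis
      by (simp add: gbinomial_minus binomial_gbinomial)
  qed
  have "(\<Sum>j\<le>d. (-1) ^ j * of_nat ((j + M - 1) choose (M - 1)) * of_nat ((M + d) choose (d - j)))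
      = (\<Sum>j\<le>d. ((- of_nat M :: rat) gchoose j) * (of_nat (M + d) gchoose (d - j)))"
    by (simp only: upper_negation) (simp only: binomial_gbinomial)
  also have "\<dots> = (- of_nat M + of_nat (M + d)) gchoose d"
    by (simp only: gbinomial_Vandermonde flip: atLeast0AtMost)
  also have "\<dots> = of_nat (d choose d)"
    by (simp only: binomial_gbinomial) simp
  finally have "of_int (\<Sum>j\<le>d. (-1) ^ j * of_nat ((j + M - 1) choose (M - 1)) * of_nat ((M + d) choose (d - j)))
      = (of_int 1 :: rat)"
    by simp
  \<comment> \<open>The identity of rationals is one of integers, which then maps into every ring.\<close>
  then have "(\<Sum>j\<le>d. (-1) ^ j * of_nat ((j + M - 1) choose (M - 1)) * of_nat ((M + d) choose (d - j)))
      = (1 :: int)"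
    by (simp only: of_int_eq_iff)
  from arg_cong [OF this, of "of_int :: int \<Rightarrow> 'a"] show ?thesis
    by simp
qed

lemma card_supersets_of_size:
  assumes "finite U" "T \<subseteq> U" "card T \<le> k"
  shows "card {\<Omega>. \<Omega> \<subseteq> U \<and> card \<Omega> = k \<and> T \<subseteq> \<Omega>} = (card U - card T) choose (k - card T)"
proof -
  have fin_T: "finite T"
    using assms finite_subset by blast
  have fin: "finite R" if "R \<subseteq> U - T" for R
    using that assms(1) by (meson finite_Diff finite_subset)
  have "bij_betw (\<lambda>R. R \<union> T) {R. R \<subseteq> U - T \<and> card R = k - card T}
          {\<Omega>. \<Omega> \<subseteq> U \<and> card \<Omega> = k \<and> T \<subseteq> \<Omega>}"
  proof (rule bij_betw_byWitness [where f' = "\<lambda>\<Omega>. \<Omega> - T"])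
    show "(\<lambda>R. R \<union> T) ` {R. R \<subseteq> U - T \<and> card R = k - card T}
        \<subseteq> {\<Omega>. \<Omega> \<subseteq> U \<and> card \<Omega> = k \<and> T \<subseteq> \<Omega>}"
    proof clarsimp
      fix R assume R: "R \<subseteq> U - T" "card R = k - card T"
      then have "card (R \<union> T) = card R + card T"
        using fin fin_T by (intro card_Un_disjoint) auto
      then show "R \<subseteq> U \<and> T \<subseteq> U \<and> card (R \<union> T) = k"
        using R assms by auto
    qed
    show "(\<lambda>\<Omega>. \<Omega> - T) ` {\<Omega>. \<Omega> \<subseteq> U \<and> card \<Omega> = k \<and> T \<subseteq> \<Omega>}
        \<subseteq> {R. R \<subseteq> U - T \<and> card R = k - card T}"
      using fin_T by (auto simp: card_Diff_subset)
  qed auto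
  then have "card {\<Omega>. \<Omega> \<subseteq> U \<and> card \<Omega> = k \<and> T \<subseteq> \<Omega>} = card {R. R \<subseteq> U - T \<and> card R = k - card T}"
    by (simp add: bij_betw_same_card)
  also have "\<dots> = card (U - T) choose (k - card T)"
    using assms(1) by (simp add: n_subsets)
  finally show ?thesis
    using assms fin_T by (simp add: card_Diff_subset)
qed

text \<open>
  Expanding every \<open>f \<Omega>\<close> and exchanging the sums, each \<open>g T\<close> with \<open>card T \<le> \<tau>\<close> is counted
  exactly once in total: this is \<open>alternating_Vandermonde\<close> with \<open>M = card U - \<tau>\<close> and
  \<open>d = \<tau> - card T\<close>.
\<close>

lemma sum_over_layers:
  fixes f g :: "'b set \<Rightarrow> 'a::comm_ring_1"
  assumes "finite U" and less: "\<tau> < card U"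
    and expansion: "\<And>\<Omega>. \<Omega> \<subseteq> U \<Longrightarrow> f \<Omega> = (\<Sum>T\<in>Pow \<Omega>. g T)"
    and small: "\<And>T. T \<subseteq> U \<Longrightarrow> g T \<noteq> 0 \<Longrightarrow> card T \<le> \<tau>"
  shows "f U = (\<Sum>j=0..\<tau>. (-1) ^ j * of_nat ((j + card U - \<tau> - 1) choose (card U - \<tau> - 1)) *
                 (\<Sum>\<Omega> | \<Omega> \<subseteq> U \<and> card \<Omega> = \<tau> - j. f \<Omega>))"
proof -
  define w :: "nat \<Rightarrow> 'a"
    where "w j = (-1) ^ j * of_nat ((j + card U - \<tau> - 1) choose (card U - \<tau> - 1))" for j
  define c where "c k T = card {\<Omega>. \<Omega> \<subseteq> U \<and> card \<Omega> = k \<and> T \<subseteq> \<Omega>}" for k T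
  have layer: "(\<Sum>\<Omega> | \<Omega> \<subseteq> U \<and> card \<Omega> = k. f \<Omega>) = (\<Sum>T\<in>Pow U. of_nat (c k T) * g T)" for k
  proof -
    have "(\<Sum>\<Omega> | \<Omega> \<subseteq> U \<and> card \<Omega> = k. f \<Omega>)
        = (\<Sum>\<Omega> | \<Omega> \<subseteq> U \<and> card \<Omega> = k. \<Sum>T | T \<in> Pow U \<and> T \<subseteq> \<Omega>. g T)"
      by (intro sum.cong refl) (auto simp: expansion intro!: sum.cong)
    also have "\<dots> = (\<Sum>T\<in>Pow U. \<Sum>\<Omega> | \<Omega> \<in> {\<Omega>. \<Omega> \<subseteq> U \<and> card \<Omega> = k} \<and> T \<subseteq> \<Omega>. g T)"
      using assms(1) by (intro sum.swap_restrict) auto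
    also have "\<dots> = (\<Sum>T\<in>Pow U. of_nat (c k T) * g T)"
      by (simp add: c_def conj_assoc)
    finally show ?thesis .
  qed
  have once: "(\<Sum>j=0..\<tau>. w j * of_nat (c (\<tau> - j) T)) = 1" if T: "T \<subseteq> U" "card T \<le> \<tau>" for T
  proof -
    define M d where "M = card U - \<tau>" and "d = \<tau> - card T"
    have sizes: "card U - card T = M + d"
      using T less by (simp add: M_def d_def)
    \<comment> \<open>Sets of size \<open>\<tau> - j\<close> with \<open>j > d\<close> are too small to contain \<open>T\<close>.\<close>
    have "c (\<tau> - j) T = 0" if "j > d" "j \<le> \<tau>" for j
    proof -
      have "card T \<le> card \<Omega>" if "\<Omega> \<subseteq> U" "T \<subseteq> \<Omega>" for \<Omega>
        using that assms(1) by (meson card_mono finite_subset)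
      moreover have "\<tau> - j < card T"
        using that T by (simp add: d_def)
      ultimately have "{\<Omega>. \<Omega> \<subseteq> U \<and> card \<Omega> = \<tau> - j \<and> T \<subseteq> \<Omega>} = {}"
        by (metis (mono_tags, lifting) empty_Collect_eq not_le)
      then show ?thesis
        by (simp only: c_def card.empty)
    qed
    then have "(\<Sum>j=0..\<tau>. w j * of_nat (c (\<tau> - j) T)) = (\<Sum>j\<le>d. w j * of_nat (c (\<tau> - j) T))"
      by (intro sum.mono_neutral_right) (auto simp: d_def not_le)
    also have "\<dots> = (\<Sum>j\<le>d. (-1) ^ j * of_nat ((j + M - 1) choose (M - 1)) * of_nat ((M + d) choose (d - j)))"
    proof (intro sum.cong refl)
      fix j assume "j \<in> {..d}"
      then have "c (\<tau> - j) T = (M + d) choose (d - j)"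
        unfolding c_def using T assms(1)
        by (subst card_supersets_of_size) (auto simp: sizes d_def add.commute)
      moreover have "j + card U - \<tau> - 1 = j + M - 1"
        using less by (simp add: M_def)
      ultimately show "w j * of_nat (c (\<tau> - j) T)
          = (-1) ^ j * of_nat ((j + M - 1) choose (M - 1)) * of_nat ((M + d) choose (d - j))"
        by (simp add: w_def M_def)
    qed
    also have "\<dots> = 1"
      using less by (intro alternating_Vandermonde) (simp add: M_def)
    finally show ?thesis .
  qed
  have "(\<Sum>j=0..\<tau>. w j * (\<Sum>\<Omega> | \<Omega> \<subseteq> U \<and> card \<Omega> = \<tau> - j. f \<Omega>))
      = (\<Sum>T\<in>Pow U. \<Sum>j=0..\<tau>. w j * (of_nat (c (\<tau> - j) T) * g T))"
    unfolding layer sum_distrib_left by (rule sum.swap)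
  also have "\<dots> = (\<Sum>T\<in>Pow U. (\<Sum>j=0..\<tau>. w j * of_nat (c (\<tau> - j) T)) * g T)"
    by (simp add: sum_distrib_right mult.assoc)
  also have "\<dots> = (\<Sum>T\<in>Pow U. g T)"
  proof (intro sum.cong refl)
    fix T assume "T \<in> Pow U"
    then show "(\<Sum>j=0..\<tau>. w j * of_nat (c (\<tau> - j) T)) * g T = g T"
      using once [of T] small [of T] by (cases "g T = 0") auto
  qed
  also have "\<dots> = f U"
    by (simp add: expansion)
  finally show ?thesis
    by (simp add: w_def)
qed

section \<open>Weights of polynomial-valued set functions\<close>

text \<open>
  The bound is imposed on every exponent that occurs in \<open>g T\<close> rather than on the degree, so that
  \<open>g T = 0\<close> is possible for sets \<open>T\<close> of any size.
\<close>

definition has_weight :: "nat \<Rightarrow> ('b set \<Rightarrow> 'a::comm_ring_1 poly) \<Rightarrow> bool" where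
  "has_weight m p \<longleftrightarrow>
     (\<exists>g. (\<forall>\<Omega>. finite \<Omega> \<longrightarrow> p \<Omega> = (\<Sum>T\<in>Pow \<Omega>. g T)) \<and>
          (\<forall>T i. coeff (g T) i \<noteq> 0 \<longrightarrow> i + card T \<le> m))"

lemma has_weightI:
  assumes "\<And>\<Omega>. finite \<Omega> \<Longrightarrow> p \<Omega> = (\<Sum>T\<in>Pow \<Omega>. g T)"
    and "\<And>T i. coeff (g T) i \<noteq> 0 \<Longrightarrow> i + card T \<le> m"
  shows "has_weight m p"
  using assms unfolding has_weight_def by blast

lemma has_weightE:
  assumes "has_weight m p"
  obtains g where "\<And>\<Omega>. finite \<Omega> \<Longrightarrow> p \<Omega> = (\<Sum>T\<in>Pow \<Omega>. g T)"
    and "\<And>T i. coeff (g T) i \<noteq> 0 \<Longrightarrow> i + card T \<le> m"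
  using assms unfolding has_weight_def by blast

lemma has_weight_const:
  assumes "degree q \<le> m"
  shows "has_weight m (\<lambda>\<Omega>. q)"
proof (rule has_weightI [where g = "\<lambda>T. if T = {} then q else 0"])
  show "q = (\<Sum>T\<in>Pow \<Omega>. if T = {} then q else 0)" if "finite \<Omega>" for \<Omega>
    using that by (simp add: sum.delta)
qed (use assms in \<open>auto split: if_splits dest: le_degree\<close>)

lemma has_weight_linear:
  "has_weight 1 (\<lambda>\<Omega>. \<Sum>k\<in>\<Omega>. [:c k:])"
proof (rule has_weightI [where g = "\<lambda>T. if card T = 1 then [:c (the_elem T):] else 0"])
  fix \<Omega> :: "'a set" assume "finite \<Omega>"
  then have "(\<Sum>T\<in>Pow \<Omega>. if card T = 1 then [:c (the_elem T):] else 0)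
      = (\<Sum>T\<in>(\<lambda>k. {k}) ` \<Omega>. if card T = 1 then [:c (the_elem T):] else 0)"
    by (intro sum.mono_neutral_right) (auto simp: card_1_singleton_iff)
  also have "\<dots> = (\<Sum>k\<in>\<Omega>. [:c k:])"
    by (subst sum.reindex) (auto simp: inj_on_def)
  finally show "(\<Sum>k\<in>\<Omega>. [:c k:]) = (\<Sum>T\<in>Pow \<Omega>. if card T = 1 then [:c (the_elem T):] else 0)"
    by simp
qed (auto simp: coeff_pCons split: if_splits nat.splits)

lemma has_weight_add:
  assumes "has_weight m p" "has_weight m q"
  shows "has_weight m (\<lambda>\<Omega>. p \<Omega> + q \<Omega>)"
proof -
  obtain g where g: "\<And>\<Omega>. finite \<Omega> \<Longrightarrow> p \<Omega> = (\<Sum>T\<in>Pow \<Omega>. g T)"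
      "\<And>T i. coeff (g T) i \<noteq> 0 \<Longrightarrow> i + card T \<le> m"
    using assms(1) by (rule has_weightE) blast
  obtain h where h: "\<And>\<Omega>. finite \<Omega> \<Longrightarrow> q \<Omega> = (\<Sum>T\<in>Pow \<Omega>. h T)"
      "\<And>T i. coeff (h T) i \<noteq> 0 \<Longrightarrow> i + card T \<le> m"
    using assms(2) by (rule has_weightE) blast
  show ?thesis
  proof (rule has_weightI [where g = "\<lambda>T. g T + h T"])
    show "i + card T \<le> m" if "coeff (g T + h T) i \<noteq> 0" for T i
      using that g(2) [of T i] h(2) [of T i] by (cases "coeff (g T) i = 0") auto
  qed (simp add: g(1) h(1) sum.distrib)
qed

lemma has_weight_mult:
  assumes "has_weight m p" "has_weight n q"
  shows "has_weight (m + n) (\<lambda>\<Omega>. p \<Omega> * q \<Omega>)"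
proof -
  obtain g where g: "\<And>\<Omega>. finite \<Omega> \<Longrightarrow> p \<Omega> = (\<Sum>T\<in>Pow \<Omega>. g T)"
      "\<And>T i. coeff (g T) i \<noteq> 0 \<Longrightarrow> i + card T \<le> m"
    using assms(1) by (rule has_weightE) blast
  obtain h where h: "\<And>\<Omega>. finite \<Omega> \<Longrightarrow> q \<Omega> = (\<Sum>T\<in>Pow \<Omega>. h T)"
      "\<And>T i. coeff (h T) i \<noteq> 0 \<Longrightarrow> i + card T \<le> n"
    using assms(2) by (rule has_weightE) blast
  show ?thesis
  proof (rule has_weightI [where g = "\<lambda>T. \<Sum>x | fst x \<union> snd x = T. g (fst x) * h (snd x)"])
    fix \<Omega> :: "'a set" assume fin: "finite \<Omega>"
    let ?P = "Pow \<Omega> \<times> Pow \<Omega>"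
    have "p \<Omega> * q \<Omega> = (\<Sum>x\<in>?P. g (fst x) * h (snd x))"
      using fin by (simp add: g(1) h(1) sum_product sum.cartesian_product case_prod_unfold)
    also have "\<dots> = (\<Sum>T\<in>Pow \<Omega>. \<Sum>x | x \<in> ?P \<and> fst x \<union> snd x = T. g (fst x) * h (snd x))"
      using fin by (intro sum.group [symmetric]) auto
    also have "\<dots> = (\<Sum>T\<in>Pow \<Omega>. \<Sum>x | fst x \<union> snd x = T. g (fst x) * h (snd x))"
      by (intro sum.cong refl) auto
    finally show "p \<Omega> * q \<Omega> = (\<Sum>T\<in>Pow \<Omega>. \<Sum>x | fst x \<union> snd x = T. g (fst x) * h (snd x))" .
  next
    fix T :: "'a set" and i
    assume "coeff (\<Sum>x | fst x \<union> snd x = T. g (fst x) * h (snd x)) i \<noteq> 0"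
    then have "(\<Sum>x | fst x \<union> snd x = T. coeff (g (fst x) * h (snd x)) i) \<noteq> 0"
      by (simp add: coeff_sum)
    then obtain x where "x \<in> {x. fst x \<union> snd x = T}" "coeff (g (fst x) * h (snd x)) i \<noteq> 0"
      by (rule sum.not_neutral_contains_not_neutral)
    then obtain T1 T2 where T: "T1 \<union> T2 = T" and "coeff (g T1 * h T2) i \<noteq> 0"
      by auto
    then have "(\<Sum>k\<le>i. coeff (g T1) k * coeff (h T2) (i - k)) \<noteq> 0"
      by (simp add: coeff_mult)
    then obtain k where k: "k \<le> i" and "coeff (g T1) k * coeff (h T2) (i - k) \<noteq> 0"
      by (rule sum.not_neutral_contains_not_neutral) auto
    then have "k + card T1 \<le> m" "i - k + card T2 \<le> n"
      using g(2) h(2) by (metis mult_zero_left, metis mult_zero_right)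
    then show "i + card T \<le> m + n"
      using k card_Un_le [of T1 T2] unfolding T by linarith
  qed
qed

lemma has_weight_sum:
  assumes "\<And>x. x \<in> X \<Longrightarrow> has_weight m (p x)"
  shows "has_weight m (\<lambda>\<Omega>. \<Sum>x\<in>X. p x \<Omega>)"
  using assms
  by (induction X rule: infinite_finite_induct) (auto intro: has_weight_const has_weight_add)

lemma has_weight_prod:
  assumes "\<And>x. x \<in> X \<Longrightarrow> has_weight 1 (p x)"
  shows "has_weight (card X) (\<lambda>\<Omega>. \<Prod>x\<in>X. p x \<Omega>)"
  using assms
proof (induction X rule: infinite_finite_induct)
  case (insert x X)
  then have "has_weight (1 + card X) (\<lambda>\<Omega>. p x \<Omega> * (\<Prod>x\<in>X. p x \<Omega>))"
    by (intro has_weight_mult) auto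
  with insert show ?case
    by simp
qed (auto intro: has_weight_const)

section \<open>The characteristic polynomial of a sum of matrices\<close>

lemma has_weight_charpoly:
  fixes A :: "'b \<Rightarrow> 'a::comm_ring_1^'n^'n"
  shows "has_weight CARD('n) (\<lambda>\<Omega>. charpoly (\<Sum>i\<in>\<Omega>. A i))"
proof -
  have entry: "has_weight 1 (\<lambda>\<Omega>. (mat (monom 1 1) - map_matrix (\<lambda>c. [:c:]) (\<Sum>k\<in>\<Omega>. A k)) $ i $ j)"
    for i j :: 'n
  proof -
    have const_sum: "[:\<Sum>k\<in>\<Omega>. c k:] = (\<Sum>k\<in>\<Omega>. [:c k:])" for \<Omega> and c :: "'b \<Rightarrow> 'a"
      by (rule poly_eqI) (simp add: coeff_sum coeff_pCons split: nat.splits)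
    have eq: "(mat (monom 1 1) - map_matrix (\<lambda>c. [:c:]) (\<Sum>k\<in>\<Omega>. A k)) $ i $ j
        = (if i = j then monom 1 1 else 0) + (\<Sum>k\<in>\<Omega>. [:- A k $ i $ j:])" for \<Omega>
      by (simp add: mat_def map_matrix_def const_sum flip: sum_negf)
    show ?thesis
      unfolding eq
      by (intro has_weight_add has_weight_linear has_weight_const)
        (auto simp: degree_monom_le)
  qed
  have "has_weight (0 + CARD('n)) (\<lambda>\<Omega>. of_int (sign \<pi>) *
      (\<Prod>i\<in>UNIV. (mat (monom 1 1) - map_matrix (\<lambda>c. [:c:]) (\<Sum>k\<in>\<Omega>. A k)) $ i $ \<pi> i))"
    for \<pi> :: "'n \<Rightarrow> 'n"
    by (intro has_weight_mult has_weight_prod has_weight_const entry) simp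
  then show ?thesis
    unfolding charpoly_def det_def by (intro has_weight_sum) simp
qed

text \<open>
  For \<open>\<tau> \<le> n\<close>, a term of the weight \<open>n\<close> expansion of the characteristic polynomial that
  contributes to the coefficient at \<open>n - \<tau>\<close> is indexed by a set \<open>T\<close> with \<open>n - \<tau> + card T \<le> n\<close>.
\<close>

lemma elem_sym_sum_expansion:
  fixes A :: "'b \<Rightarrow> 'a::field^'n^'n"
  obtains g where "\<And>\<Omega>. finite \<Omega> \<Longrightarrow> elem_sym \<tau> (\<Sum>i\<in>\<Omega>. A i) = (\<Sum>T\<in>Pow \<Omega>. g T)"
    and "\<And>T. g T \<noteq> 0 \<Longrightarrow> card T \<le> \<tau>"
proof (cases "\<tau> \<le> CARD('n)")
  case True
  obtain G where G: "\<And>\<Omega>. finite \<Omega> \<Longrightarrow> charpoly (\<Sum>i\<in>\<Omega>. A i) = (\<Sum>T\<in>Pow \<Omega>. G T)"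
      "\<And>T i. coeff (G T) i \<noteq> 0 \<Longrightarrow> i + card T \<le> CARD('n)"
    using has_weight_charpoly [of A] by (rule has_weightE) blast
  show ?thesis
  proof (rule that [where g = "\<lambda>T. (-1) ^ \<tau> * coeff (G T) (CARD('n) - \<tau>)"])
    show "card T \<le> \<tau>" if "(-1) ^ \<tau> * coeff (G T) (CARD('n) - \<tau>) \<noteq> 0" for T
      using that True G(2) [of T "CARD('n) - \<tau>"] by auto
  qed (use True in \<open>simp add: elem_sym_def G(1) coeff_sum sum_distrib_left\<close>)
next
  case False
  then show ?thesis
    by (intro that [where g = "\<lambda>T. 0"]) (auto simp: elem_sym_def)
qed

lemma elem_sym_zero_matrix:
  assumes "\<tau> > 0"
  shows "elem_sym \<tau> (0 :: 'a::field^'n^'n) = 0"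
proof -
  have "charpoly (0 :: 'a^'n^'n) = (\<Prod>i\<in>(UNIV :: 'n set). monom 1 1)"
    unfolding charpoly_def by (subst det_diagonal) (auto simp: mat_def map_matrix_def)
  also have "\<dots> = monom 1 CARD('n)"
    by (simp add: monom_power)
  finally show ?thesis
    using assms by (auto simp: elem_sym_def)
qed

section \<open>The identity\<close>

(* For \<tau> = 0 the index set {0..\<tau> - 1} on nat is {0}, and the right-hand side is the single term
   j = 0, the contribution of the empty formal sum. *)
theorem corollary2p6:
  fixes A :: "nat \<Rightarrow> 'a::field^'n^'n" and N \<tau> :: nat
  assumes "N \<ge> \<tau> + 1"
  shows "elem_sym \<tau> (\<Sum>i=1..N. A i) =
    (\<Sum>j=0..\<tau>-1. (-1) ^ j * of_nat ((j + N - \<tau> - 1) choose (N - \<tau> - 1)) *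
       (\<Sum>\<Omega> | \<Omega> \<in> formal_sums N \<and> card \<Omega> = \<tau> - j. elem_sym \<tau> (\<Sum>i\<in>\<Omega>. A i)))"
proof -
  define f where "f \<Omega> = elem_sym \<tau> (\<Sum>i\<in>\<Omega>. A i)" for \<Omega>
  define summand where "summand j = (-1) ^ j * of_nat ((j + N - \<tau> - 1) choose (N - \<tau> - 1)) *
       (\<Sum>\<Omega> | \<Omega> \<subseteq> {1..N} \<and> card \<Omega> = \<tau> - j. f \<Omega>)" for j
  obtain g where g: "\<And>\<Omega>. finite \<Omega> \<Longrightarrow> f \<Omega> = (\<Sum>T\<in>Pow \<Omega>. g T)"
      "\<And>T. g T \<noteq> 0 \<Longrightarrow> card T \<le> \<tau>"
    unfolding f_def using elem_sym_sum_expansion [of \<tau> A] by blast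
  have "f {1..N} = (\<Sum>j=0..\<tau>. summand j)"
    using sum_over_layers [of "{1..N}" \<tau> f g] assms g
    by (simp add: summand_def finite_subset)
  also have "\<dots> = (\<Sum>j=0..\<tau>-1. summand j)"
  proof (cases \<tau>)
    case (Suc t)
    have "{\<Omega>. \<Omega> \<subseteq> {1..N} \<and> card \<Omega> = 0} = {{}}"
      by (auto dest: finite_subset)
    then have "summand \<tau> = 0"
      using Suc by (simp add: summand_def f_def elem_sym_zero_matrix)
    then show ?thesis
      using Suc by simp
  qed simp
  finally show ?thesis
    by (simp add: f_def summand_def formal_sums_def)
qed

end
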